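(* Let $\mathcal D=\{d_1,\ldots,d_M\}\subset\mathbb S^2$ with $M\le5$. Then there is a matrix $F_*\in\mathrm{SL}(3,\mathbb R)$ such that the map $$B\longmapsto\bigl(\tau_j(F_* )^\top B\,\tau_j(F_* )\bigr)_{j=1}^M,\qquad\tau_j(F_* )=\frac{F_*d_j}{|F_*d_j|},$$ is not injective on the space of trace-free real symmetric $3\times3$ matrices, and such that $F_*$ is attained as a deformation gradient $\nabla_aX(a,T)=F_*$ at some material point $a\in\mathbb T^3$ and some time $T>0$ by an exact smooth periodic solution of the Euler equations and, for every $\nu>0$, by an exact smooth periodic solution of the Navier--Stokes equations with viscosity $\nu$.
   Context: $\mathbb T^3=(\mathbb R/2\pi\mathbb Z)^3$. The equations are $\partial_tu+u\cdot\nabla u+\nabla p=\nu\Delta u$, $\nabla\cdot u=0$ on $\mathbb T^3$ without force ($\nu=0$ is Euler, $\nu>0$ is Navier--Stokes). The Lagrangian flow is $\partial_tX(a,t)=u(X(a,t),t)$, $X(a,0)=a$, and $\nabla_aX$ is its Jacobian matrix in $a$. *)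

theory Defs
  imports "HOL-Analysis.Analysis"
begin

text \<open>
  \<open>Ck_on k S f\<close>: \<open>f\<close> is \<open>k\<close> times continuously differentiable on \<open>S\<close>, all derivatives being taken
  within \<open>S\<close>. It is meant for sets on which the derivative within \<open>S\<close> is unique, such as open sets
  or convex sets with nonempty interior; below it is used for \<open>S = {0..} \<times> UNIV\<close>, where time
  derivatives at time 0 are one-sided.
\<close>
primrec Ck_on ::
  "nat \<Rightarrow> 'a::euclidean_space set \<Rightarrow> ('a \<Rightarrow> 'b::euclidean_space) \<Rightarrow> bool"
where
  "Ck_on 0 S f \<longleftrightarrow> continuous_on S f"
| "Ck_on (Suc k) S f \<longleftrightarrow>
     (\<exists>D. (\<forall>x\<in>S. (f has_derivative D x) (at x within S)) \<and> (\<forall>v. Ck_on k S (\<lambda>x. D x v)))"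

definition smooth_on ::
  "'a::euclidean_space set \<Rightarrow> ('a \<Rightarrow> 'b::euclidean_space) \<Rightarrow> bool"
where
  "smooth_on S f \<longleftrightarrow> (\<forall>k. Ck_on k S f)"

text \<open>
  Functions on the torus \<open>(\<real> / 2\<pi>\<int>)\<^sup>3\<close> are represented by their \<open>2\<pi>\<close>-periodic lifts to \<open>\<real>\<^sup>3\<close>, and
  points of the torus by arbitrary representatives in \<open>\<real>\<^sup>3\<close>.
\<close>
definition torus_periodic :: "(real^3 \<Rightarrow> 'b) \<Rightarrow> bool" where
  "torus_periodic f \<longleftrightarrow> (\<forall>x i. f (x + (2 * pi) *\<^sub>R axis i 1) = f x)"

definition partial :: "3 \<Rightarrow> (real^3 \<Rightarrow> 'b::real_normed_vector) \<Rightarrow> real^3 \<Rightarrow> 'b" where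
  "partial i f x = frechet_derivative f (at x) (axis i 1)"

definition gradient :: "(real^3 \<Rightarrow> real) \<Rightarrow> real^3 \<Rightarrow> real^3" where
  "gradient f x = (\<chi> i. partial i f x)"

definition divergence :: "(real^3 \<Rightarrow> real^3) \<Rightarrow> real^3 \<Rightarrow> real" where
  "divergence v x = (\<Sum>i\<in>UNIV. partial i v x $ i)"

definition laplacian :: "(real^3 \<Rightarrow> 'b::real_normed_vector) \<Rightarrow> real^3 \<Rightarrow> 'b" where
  "laplacian f x = (\<Sum>i\<in>UNIV. partial i (partial i f) x)"

definition advection :: "(real^3 \<Rightarrow> real^3) \<Rightarrow> (real^3 \<Rightarrow> real^3) \<Rightarrow> real^3 \<Rightarrow> real^3" where
  "advection u v x = (\<Sum>i\<in>UNIV. (u x $ i) *\<^sub>R partial i v x)"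

text \<open>
  Smooth solutions, global in forward time, of the unforced incompressible equations on the torus
  with velocity \<open>u t x\<close>, pressure \<open>p t x\<close> and viscosity \<open>\<nu>\<close>.
\<close>
definition navier_stokes_solution ::
  "real \<Rightarrow> (real \<Rightarrow> real^3 \<Rightarrow> real^3) \<Rightarrow> (real \<Rightarrow> real^3 \<Rightarrow> real) \<Rightarrow> bool"
where
  "navier_stokes_solution \<nu> u p \<longleftrightarrow>
     smooth_on ({0..} \<times> UNIV) (\<lambda>(t, x). u t x) \<and>
     smooth_on ({0..} \<times> UNIV) (\<lambda>(t, x). p t x) \<and>
     (\<forall>t\<ge>0. torus_periodic (u t) \<and> torus_periodic (p t)) \<and>
     (\<forall>t\<ge>0. \<forall>x.
        vector_derivative (\<lambda>s. u s x) (at t within {0..}) + advection (u t) (u t) x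
          + gradient (p t) x = \<nu> *\<^sub>R laplacian (u t) x \<and>
        divergence (u t) x = 0)"

abbreviation euler_solution ::
  "(real \<Rightarrow> real^3 \<Rightarrow> real^3) \<Rightarrow> (real \<Rightarrow> real^3 \<Rightarrow> real) \<Rightarrow> bool"
where
  "euler_solution \<equiv> navier_stokes_solution 0"

text \<open>The Lagrangian flow, lifted from the torus to \<open>\<real>\<^sup>3\<close>.\<close>
definition lagrangian_flow ::
  "(real \<Rightarrow> real^3 \<Rightarrow> real^3) \<Rightarrow> (real^3 \<Rightarrow> real \<Rightarrow> real^3) \<Rightarrow> bool"
where
  "lagrangian_flow u X \<longleftrightarrow>
     (\<forall>a. X a 0 = a \<and>
        (\<forall>t\<ge>0. (X a has_vector_derivative u t (X a t)) (at t within {0..})))"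

definition attains_deformation_gradient ::
  "(real \<Rightarrow> real^3 \<Rightarrow> real^3) \<Rightarrow> real^3 \<Rightarrow> real \<Rightarrow> real^3^3 \<Rightarrow> bool"
where
  "attains_deformation_gradient u a T F \<longleftrightarrow>
     (\<exists>X. lagrangian_flow u X \<and> ((\<lambda>b. X b T) has_derivative (\<lambda>h. F *v h)) (at a))"

definition trace_free_symmetric :: "(real^3^3) set" where
  "trace_free_symmetric = {B. transpose B = B \<and> trace B = 0}"

definition deformed_direction :: "real^3^3 \<Rightarrow> real^3 \<Rightarrow> real^3" where
  "deformed_direction F d = (F *v d) /\<^sub>R norm (F *v d)"

text \<open>The value in \<open>\<real>\<^sup>M\<close> is represented as a function with index set \<open>{1..M}\<close>.\<close>
definition measurement_map ::
  "nat \<Rightarrow> (nat \<Rightarrow> real^3) \<Rightarrow> real^3^3 \<Rightarrow> real^3^3 \<Rightarrow> (nat \<Rightarrow> real)"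
where
  "measurement_map M d F B =
     (\<lambda>j\<in>{1..M}. deformed_direction F (d j) \<bullet> (B *v deformed_direction F (d j)))"

end

theory Submission
  imports Defs
begin

text \<open>
  The symmetric matrices \<open>A\<close> with \<open>d\<^sub>j \<bullet> A d\<^sub>j = 0\<close> for at most five \<open>d\<^sub>j\<close> form a nonzero
  space, and \<open>B = F\<^sup>-\<^sup>T A F\<^sup>-\<^sup>1\<close> is a nonzero matrix in the kernel of the measurement map as soon
  as its trace vanishes. For a shear \<open>F = 1 + s v k\<^sup>T\<close> with \<open>k \<bullet> v = 0\<close> that trace is
  \<open>tr A - 2s (v \<bullet> A k) + s\<^sup>2 |k|\<^sup>2 (v \<bullet> A v)\<close>, which has a real root \<open>s\<close> when \<open>tr A \<ge> 0\<close> and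
  \<open>v \<bullet> A v < 0\<close>; by density \<open>v\<close> may be taken orthogonal to an integer vector \<open>k\<close>. If \<open>A\<close> is
  positive semidefinite, all \<open>d\<^sub>j\<close> lie in a common plane \<open>n\<^sup>\<bottom>\<close>, and \<open>n w\<^sup>T + w n\<^sup>T\<close> with
  \<open>w \<bullet> n = 0\<close> is already trace-free. Every shear with integer \<open>k\<close> is realised at \<open>a = 0\<close>, \<open>T = 1\<close>
  by the parallel flow \<open>c e\<^bsup>-\<nu>|k|\<^sup>2t\<^esup> sin (k \<bullet> x) v\<close>, whose amplitude \<open>c\<close> absorbs the viscous decay.
\<close>

section \<open>Parallel flows\<close>

text \<open>Both phases are kept so that the family is closed under differentiation. The value type
  is left open so that the zero scalar pressure is an instance too.\<close>

definition wave :: "real^3 \<Rightarrow> 'b::real_normed_vector \<Rightarrow> real \<Rightarrow> real \<Rightarrow> real^3 \<Rightarrow> 'b" where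
  "wave k w a b x = (a * sin (k \<bullet> x) + b * cos (k \<bullet> x)) *\<^sub>R w"

text \<open>Every directional derivative is again a decaying wave with the same \<open>k\<close>,
  \<open>l\<close> and \<open>w\<close>; only the coefficients change. Hence the induction on the
  order is over all \<open>a\<close> and \<open>b\<close>.\<close>

lemma smooth_on_decaying_wave:
  fixes w :: "'b::euclidean_space"
  shows "smooth_on S (\<lambda>(t, x). exp (- l * t) *\<^sub>R wave k w a b x)"
proof -
  have "Ck_on n S (\<lambda>(t, x). exp (- l * t) *\<^sub>R wave k w a b x)" for n
  proof (induction n arbitrary: a b)
    case 0
    show ?case
      unfolding Ck_on.simps wave_def split_beta by (intro continuous_intros)
  next
    case (Suc n)
    define D where "D = (\<lambda>(t::real, x) (\<tau>, h). exp (- l * t) *\<^sub>R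
      wave k w (- l * \<tau> * a - b * (k \<bullet> h)) (- l * \<tau> * b + a * (k \<bullet> h)) x)"
    have "((\<lambda>(t, x). exp (- l * t) *\<^sub>R wave k w a b x) has_derivative D z) (at z within S)" for z
      unfolding wave_def split_beta D_def
      by (auto intro!: derivative_eq_intros ext simp: algebra_simps)
    moreover have "Ck_on n S (\<lambda>z. D z y)" for y
      using Suc.IH by (cases y) (simp add: D_def split_beta)
    ultimately show ?case
      unfolding Ck_on.simps by blast
  qed
  then show ?thesis
    by (simp add: smooth_on_def)
qed

lemma partial_wave: "partial i (wave k w a b) = wave k w (- b * k $ i) (a * k $ i)"
proof
  fix x
  have "(wave k w a b has_derivative (\<lambda>h. wave k w (- b * (k \<bullet> h)) (a * (k \<bullet> h)) x)) (at x)"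
    unfolding wave_def
    by (auto intro!: derivative_eq_intros ext simp: algebra_simps)
  then have "frechet_derivative (wave k w a b) (at x)
      = (\<lambda>h. wave k w (- b * (k \<bullet> h)) (a * (k \<bullet> h)) x)"
    by (rule frechet_derivative_at[symmetric])
  then show "partial i (wave k w a b) x = wave k w (- b * k $ i) (a * k $ i) x"
    by (simp add: partial_def inner_axis)
qed

lemma laplacian_wave: "laplacian (wave k w a b) x = - (k \<bullet> k) *\<^sub>R wave k w a b x"
  by (simp add: laplacian_def partial_wave wave_def sum_3 inner_vec_def algebra_simps)

lemma scaleR_wave: "c *\<^sub>R wave k w a b x = wave k w (c * a) (c * b) x"
  by (simp add: wave_def algebra_simps)

lemma divergence_wave:
  assumes "k \<bullet> v = 0"
  shows "divergence (wave k v a b) x = 0"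
proof -
  have "divergence (wave k v a b) x = (a * cos (k \<bullet> x) - b * sin (k \<bullet> x)) * (k \<bullet> v)"
    by (simp add: divergence_def partial_wave wave_def sum_3 inner_vec_def algebra_simps)
  with assms show ?thesis by simp
qed

text \<open>The velocity points along \<open>v\<close> while the wave varies only along
  \<open>k\<close>, so transport carries the factor \<open>k \<bullet> v\<close>.\<close>

lemma advection_wave:
  assumes "k \<bullet> v = 0"
  shows "advection (wave k v a b) (wave k v a b) x = 0"
proof -
  have "advection (wave k v a b) (wave k v a b) x
      = ((a * sin (k \<bullet> x) + b * cos (k \<bullet> x)) * (k \<bullet> v)) *\<^sub>R wave k v (- b) a x"
    by (simp add: advection_def partial_wave wave_def sum_3 inner_vec_def algebra_simps)
  with assms show ?thesis by simp
qed

lemma torus_periodic_wave: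
  assumes "\<And>i. k $ i \<in> \<int>"
  shows "torus_periodic (wave k w a b)"
proof -
  have "sin (k \<bullet> (x + (2 * pi) *\<^sub>R axis i 1)) = sin (k \<bullet> x) \<and>
        cos (k \<bullet> (x + (2 * pi) *\<^sub>R axis i 1)) = cos (k \<bullet> x)" for x i
  proof -
    obtain m where m: "k $ i = of_int m"
      using assms Ints_cases by metis
    have "k \<bullet> (x + (2 * pi) *\<^sub>R axis i 1) = k \<bullet> x + 2 * pi * of_int m"
      by (simp add: inner_add_right inner_axis m)
    then show ?thesis
      by (simp add: sin_add cos_add)
  qed
  then show ?thesis
    by (simp add: torus_periodic_def wave_def)
qed

text \<open>With the nonlinearity gone, zero pressure suffices and the heat equation remains. The
  wave is an eigenfunction of the Laplacian for \<open>- (k \<bullet> k)\<close>, which fixes the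
  decay rate.\<close>

lemma navier_stokes_solution_wave:
  assumes k: "\<And>i. k $ i \<in> \<int>" and kv: "k \<bullet> v = 0"
  shows "navier_stokes_solution \<nu>
    (\<lambda>t. wave k v (c * exp (- (\<nu> * (k \<bullet> k)) * t)) 0) (\<lambda>_ _. 0)"
proof -
  define l where "l = \<nu> * (k \<bullet> k)"
  define u where "u = (\<lambda>t. wave k v (c * exp (- l * t)) 0)"
  have "(\<lambda>(t, x). u t x) = (\<lambda>(t, x). exp (- l * t) *\<^sub>R wave k v c 0 x)"
    by (auto simp: u_def scaleR_wave mult.commute)
  then have "smooth_on ({0..} \<times> UNIV) (\<lambda>(t, x). u t x)"
    by (simp only: smooth_on_decaying_wave)
  moreover have "smooth_on ({0..} \<times> UNIV) (\<lambda>(t::real, x::real^3). 0::real)"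
    using smooth_on_decaying_wave[of "{0..} \<times> UNIV" 0 0 "0::real" 0 0]
    by (simp add: wave_def)
  moreover have "torus_periodic (u t)" for t
    using torus_periodic_wave[OF k] by (simp add: u_def)
  moreover have "torus_periodic (\<lambda>_. 0::real)"
    by (simp add: torus_periodic_def)
  moreover have "vector_derivative (\<lambda>s. u s x) (at t within {0..}) = - l *\<^sub>R u t x"
    if "t \<ge> 0" for t x
  proof (rule vector_derivative_within)
    \<comment> \<open>The derivative within the half-line is unique because right neighbourhoods
      already make the filter nontrivial, also at time 0.\<close>
    have "at_right t \<le> at t within {0..}"
      by (rule at_le) (use that in auto)
    then show "at t within {0..} \<noteq> bot"
      using trivial_limit_at_right_real bot_unique by metis
    show "((\<lambda>s. u s x) has_vector_derivative - l *\<^sub>R u t x) (at t within {0..})"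
      unfolding u_def wave_def has_vector_derivative_def
      by (auto intro!: derivative_eq_intros ext simp: algebra_simps)
  qed
  moreover have "gradient (\<lambda>_. 0) x = 0" for x
    by (simp add: gradient_def partial_def vec_eq_iff)
  moreover have "\<nu> *\<^sub>R laplacian (u t) x = - l *\<^sub>R u t x" for t x
    by (simp add: u_def laplacian_wave l_def)
  moreover have "advection (u t) (u t) x = 0" "divergence (u t) x = 0" for t x
    using kv by (simp_all add: u_def advection_wave divergence_wave)
  ultimately have "navier_stokes_solution \<nu> u (\<lambda>_ _. 0)"
    by (simp add: navier_stokes_solution_def)
  then show ?thesis
    by (simp add: u_def l_def)
qed

section \<open>Shears as deformation gradients of parallel flows\<close>

definition shear :: "real \<Rightarrow> real^3 \<Rightarrow> real^3 \<Rightarrow> real^3^3" where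
  "shear s v k = (\<chi> i j. (if i = j then 1 else 0) + s * v $ i * k $ j)"

lemma shear_mult: "shear s v k *v h = h + (s * (k \<bullet> h)) *\<^sub>R v"
  by (simp add: vec_eq_iff shear_def matrix_vector_mult_def sum_3 inner_vec_def forall_3 algebra_simps)

text \<open>The phase \<open>k \<bullet> X a t\<close> is conserved because particles move along
  \<open>v\<close>. Each path is therefore straight, and integrating the amplitude \<open>E\<close>
  to its primitive \<open>\<phi>\<close> gives the flow explicitly.\<close>

lemma attains_deformation_gradient_wave:
  assumes kv: "k \<bullet> v = 0"
    and \<phi>: "\<And>t. (\<phi> has_real_derivative E t) (at t)" "\<phi> 0 = 0"
  shows "attains_deformation_gradient (\<lambda>t. wave k v (c * E t) 0) 0 T (shear (c * \<phi> T) v k)"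
proof -
  define X where "X = (\<lambda>a t. a + wave k v (c * \<phi> t) 0 a)"
  have "k \<bullet> X a t = k \<bullet> a" for a t
    by (simp add: X_def wave_def inner_add_right kv)
  then have "wave k v (c * E t) 0 (X a t) = wave k v (c * E t) 0 a" for a t
    by (simp add: wave_def)
  moreover have "(X a has_vector_derivative wave k v (c * E t) 0 a) (at t within {0..})" for a t
    unfolding X_def wave_def
    by (rule has_vector_derivative_eq_rhs,
        (rule derivative_intros DERIV_subset[OF \<phi>(1)] subset_UNIV)+) simp
  ultimately have "lagrangian_flow (\<lambda>t. wave k v (c * E t) 0) X"
    by (simp add: lagrangian_flow_def) (simp add: X_def wave_def \<phi>(2))
  \<comment> \<open>At the origin the cosine of the phase is 1, so the gradient of the sine is
    exactly \<open>k\<close>.\<close>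
  moreover have "((\<lambda>b. X b T) has_derivative (\<lambda>h. shear (c * \<phi> T) v k *v h)) (at 0)"
    unfolding X_def wave_def shear_mult
    by (auto intro!: derivative_eq_intros ext simp: algebra_simps)
  ultimately show ?thesis
    unfolding attains_deformation_gradient_def by blast
qed

lemma shear_attained:
  assumes "\<And>i. k $ i \<in> \<int>" and "k \<bullet> v = 0" and "\<nu> \<ge> 0"
  shows "\<exists>u p. navier_stokes_solution \<nu> u p \<and> attains_deformation_gradient u 0 1 (shear s v k)"
proof -
  define l where "l = \<nu> * (k \<bullet> k)"
  have "l \<ge> 0"
    using assms by (simp add: l_def)
  \<comment> \<open>The integral of \<open>exp (- l * t)\<close> from 0; the case
    \<open>l = 0\<close> covers Euler.\<close>
  define \<phi> where "\<phi> = (\<lambda>t. if l = 0 then t else (1 - exp (- l * t)) / l)"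
  have "(\<phi> has_real_derivative exp (- l * t)) (at t)" for t
    by (cases "l = 0") (auto simp: \<phi>_def intro!: derivative_eq_intros)
  moreover have "\<phi> 0 = 0"
    by (simp add: \<phi>_def)
  \<comment> \<open>Dividing by \<open>\<phi> 1\<close> compensates the decay up to time 1, so every
    viscosity yields the same shear.\<close>
  ultimately have "attains_deformation_gradient
      (\<lambda>t. wave k v (s / \<phi> 1 * exp (- l * t)) 0) 0 1 (shear (s / \<phi> 1 * \<phi> 1) v k)"
    by (rule attains_deformation_gradient_wave[OF assms(2)])
  moreover have "\<phi> 1 \<noteq> 0"
    by (simp add: \<phi>_def)
  moreover have "navier_stokes_solution \<nu>
      (\<lambda>t. wave k v (s / \<phi> 1 * exp (- l * t)) 0) (\<lambda>_ _. 0)"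
    unfolding l_def by (rule navier_stokes_solution_wave) (use assms in auto)
  ultimately show ?thesis
    by auto
qed

section \<open>Degenerate measurements\<close>

lemma det_shear:
  assumes "k \<bullet> v = 0"
  shows "det (shear s v k) = 1"
proof -
  have "det (shear s v k) = 1 + s * (k \<bullet> v)"
    by (simp add: shear_def det_3 inner_vec_def sum_3 algebra_simps)
  with assms show ?thesis by simp
qed

text \<open>The rank-one part of the shear squares to zero when
  \<open>k \<bullet> v = 0\<close>.\<close>

lemma shear_inverse:
  assumes "k \<bullet> v = 0"
  shows "shear (- s) v k *v (shear s v k *v h) = h"
  using assms by (simp add: shear_mult inner_add_right)

section \<open>Congruence by a shear and the trace\<close>

lemma inner_congruence:
  fixes A G :: "real^'n^'n"
  shows "x \<bullet> ((transpose G ** A ** G) *v y) = (G *v x) \<bullet> (A *v (G *v y))"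
  by (metis dot_lmul_matrix matrix_vector_mul_assoc transpose_matrix_vector transpose_transpose)

lemma inner_symmetric_matrix:
  fixes A :: "real^'n^'n"
  assumes "transpose A = A"
  shows "x \<bullet> (A *v y) = y \<bullet> (A *v x)"
  using assms by (metis dot_lmul_matrix inner_commute transpose_matrix_vector)

lemma trace_eq_sum_axis: "trace A = (\<Sum>i\<in>UNIV. axis i 1 \<bullet> (A *v axis i (1::real)))"
  by (simp add: trace_def inner_axis' matrix_vector_mult_basis column_def)

text \<open>The trace sums the quadratic form of \<open>A\<close> over the columns
  \<open>axis i 1 + (s * k $ i) *\<^sub>R v\<close> of the shear.\<close>

lemma trace_congruence_shear:
  assumes "transpose A = A"
  shows "trace (transpose (shear s v k) ** A ** shear s v k)
    = trace A + 2 * s * (v \<bullet> (A *v k)) + s\<^sup>2 * (k \<bullet> k) * (v \<bullet> (A *v v))"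
proof -
  have "(axis i 1 + (s * k $ i) *\<^sub>R v) \<bullet> (A *v (axis i 1 + (s * k $ i) *\<^sub>R v))
      = axis i 1 \<bullet> (A *v axis i 1) + 2 * s * (k $ i * (v \<bullet> (A *v axis i 1)))
        + s\<^sup>2 * (v \<bullet> (A *v v)) * (k $ i * k $ i)" for i
    using inner_symmetric_matrix[OF assms, of "axis i 1" v]
    by (simp add: matrix_vector_right_distrib matrix_vector_mult_scaleR inner_add_left
        inner_add_right power2_eq_square distrib_left)
  then have "trace (transpose (shear s v k) ** A ** shear s v k)
      = trace A + 2 * s * (\<Sum>i\<in>UNIV. k $ i * (v \<bullet> (A *v axis i 1)))
        + s\<^sup>2 * (v \<bullet> (A *v v)) * (\<Sum>i\<in>UNIV. k $ i * k $ i)"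
    by (simp add: trace_eq_sum_axis inner_congruence shear_mult inner_axis sum.distrib
        sum_distrib_left)
  moreover have "(\<Sum>i\<in>UNIV. k $ i * (v \<bullet> (A *v axis i 1))) = v \<bullet> (A *v k)"
    by (simp add: matrix_vector_mult_basis matrix_mult_sum[of A k] inner_sum_right
        scalar_mult_eq_scaleR)
  moreover have "(\<Sum>i\<in>UNIV. k $ i * k $ i) = k \<bullet> k"
    by (simp add: inner_vec_def)
  ultimately show ?thesis
    by (simp add: mult.commute mult.left_commute)
qed

text \<open>Hypothesis \<open>tr\<close> says that \<open>A\<close>, transported by the inverse
  shear, is trace-free; the sign of its linear term comes from the parameter \<open>- s\<close>.
  Normalising the deformed directions only rescales zero values.\<close>

lemma not_inj_measurement_map_shear:
  assumes kv: "k \<bullet> v = 0" and A: "A \<noteq> 0" "transpose A = A"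
    and d: "\<And>j. j \<in> {1..M} \<Longrightarrow> d j \<bullet> (A *v d j) = 0"
    and tr: "trace A - 2 * s * (v \<bullet> (A *v k)) + s\<^sup>2 * (k \<bullet> k) * (v \<bullet> (A *v v)) = 0"
  shows "\<not> inj_on (measurement_map M d (shear s v k)) trace_free_symmetric"
proof
  assume inj: "inj_on (measurement_map M d (shear s v k)) trace_free_symmetric"
  define G where "G = shear (- s) v k"
  define B where "B = transpose G ** A ** G"
  have AB: "(shear s v k *v x) \<bullet> (B *v (shear s v k *v y)) = x \<bullet> (A *v y)" for x y
    by (simp add: B_def G_def inner_congruence shear_inverse[OF kv])
  have "trace B = 0"
    using trace_congruence_shear[OF A(2), of "- s" v k] tr by (simp add: B_def G_def)
  moreover have "transpose B = B"
    by (simp add: B_def matrix_transpose_mul A(2) matrix_mul_assoc)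
  ultimately have "B \<in> trace_free_symmetric"
    by (simp add: trace_free_symmetric_def)
  moreover have "0 \<in> trace_free_symmetric"
    by (simp add: trace_free_symmetric_def trace_def transpose_def vec_eq_iff)
  moreover have "measurement_map M d (shear s v k) B = measurement_map M d (shear s v k) 0"
    unfolding measurement_map_def
    by (rule restrict_ext)
       (simp add: deformed_direction_def matrix_vector_mult_scaleR AB d)
  ultimately have "B = 0"
    using inj by (meson inj_onD)
  then have "x \<bullet> (A *v y) = 0" for x y
    using AB[of x y] by simp
  then have "A *v y = 0 *v y" for y
    by (metis inner_eq_zero_iff matrix_vector_mult_0)
  then have "A = 0"
    using matrix_eq by blast
  with A(1) show False by simp
qed

text \<open>A dimension count in the nine-dimensional matrix space: orthogonality to three skew
  matrices means symmetry, orthogonality to the at most five \<open>R j\<close> means vanishing on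
  the \<open>d j\<close>, and eight conditions leave a nonzero solution.\<close>

lemma exists_symmetric_annihilating:
  fixes d :: "nat \<Rightarrow> real^3"
  assumes "M \<le> 5"
  obtains A :: "real^3^3" where "A \<noteq> 0" "transpose A = A" "\<And>j. j \<in> {1..M} \<Longrightarrow> d j \<bullet> (A *v d j) = 0"
proof -
  define sk :: "3 \<Rightarrow> 3 \<Rightarrow> real^3^3" where
    "sk = (\<lambda>p q. axis p (axis q 1) - axis q (axis p 1))"
  define R :: "nat \<Rightarrow> real^3^3" where "R = (\<lambda>j. \<chi> p q. d j $ p * d j $ q)"
  define S where "S = R ` {1..M} \<union> {sk 1 2, sk 1 3, sk 2 3}"
  have "card S \<le> card (R ` {1..M}) + card {sk 1 2, sk 1 3, sk 2 3}"
    unfolding S_def by (rule card_Un_le)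
  also have "card (R ` {1..M}) \<le> 5"
    using card_image_le[of "{1..M}" R] assms by simp
  also have "card {sk 1 2, sk 1 3, sk 2 3} \<le> 3"
    by (simp add: card_insert_if)
  finally have "card S \<le> 8" by simp
  moreover have "dim S \<le> card S"
    by (rule dim_le_card') (simp add: S_def)
  ultimately have "dim S < DIM(real^3^3)"
    by simp
  then obtain A where A: "A \<noteq> 0" "\<And>y. y \<in> span S \<Longrightarrow> orthogonal A y"
    using orthogonal_to_subspace_exists by blast
  then have A0: "A \<bullet> y = 0" if "y \<in> S" for y
    using that by (simp add: orthogonal_def span_base)
  have "A \<bullet> sk p q = A $ p $ q - A $ q $ p" for p q
    by (simp add: sk_def inner_diff_right inner_axis)
  then have "A $ 1 $ 2 = A $ 2 $ 1" "A $ 1 $ 3 = A $ 3 $ 1" "A $ 2 $ 3 = A $ 3 $ 2"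
    using A0[of "sk 1 2"] A0[of "sk 1 3"] A0[of "sk 2 3"] by (simp_all add: S_def)
  then have "transpose A = A"
    by (simp add: vec_eq_iff transpose_def forall_3)
  moreover have "d j \<bullet> (A *v d j) = 0" if "j \<in> {1..M}" for j
  proof -
    have "d j \<bullet> (A *v d j) = A \<bullet> R j"
      by (simp add: R_def inner_vec_def matrix_vector_mult_def sum_3 algebra_simps)
    then show ?thesis
      using A0[of "R j"] that by (simp add: S_def)
  qed
  ultimately show ?thesis
    using that A(1) by blast
qed

text \<open>At \<open>d + t *\<^sub>R y\<close> with \<open>y = A *v d\<close> the form has no
  constant term and slope proportional to \<open>y \<bullet> y\<close>, so a small negative
  \<open>t\<close> would make it negative unless \<open>y = 0\<close>.\<close>

lemma psd_isotropic_in_kernel: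
  fixes A :: "real^'n^'n"
  assumes sym: "transpose A = A" and psd: "\<And>x. x \<bullet> (A *v x) \<ge> 0" and d: "d \<bullet> (A *v d) = 0"
  shows "A *v d = 0"
proof -
  define y where "y = A *v d"
  have dy: "d \<bullet> (A *v y) = y \<bullet> y"
    using inner_symmetric_matrix[OF sym] y_def by metis
  have q: "2 * t * (y \<bullet> y) + t\<^sup>2 * (y \<bullet> (A *v y)) \<ge> 0" for t
    using psd[of "d + t *\<^sub>R y"] d dy
    by (simp add: matrix_vector_right_distrib matrix_vector_mult_scaleR inner_add_left
        inner_add_right power2_eq_square algebra_simps flip: y_def)
  \<comment> \<open>Adding 1 keeps the denominator of the test value
    \<open>t = - (y \<bullet> y) / m\<close> positive even if the form vanishes at
    \<open>y\<close>.\<close>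
  define m where "m = y \<bullet> (A *v y) + 1"
  have m: "m > 0"
    using psd[of y] by (simp add: m_def)
  have "0 \<le> 2 * (- (y \<bullet> y) / m) * (y \<bullet> y) + (- (y \<bullet> y) / m)\<^sup>2 * (m - 1)"
    using q[of "- (y \<bullet> y) / m"] by (simp add: m_def)
  also have "\<dots> = - ((y \<bullet> y)\<^sup>2 * (m + 1)) / m\<^sup>2"
    using m by (simp add: field_simps power2_eq_square)
  finally have "(y \<bullet> y)\<^sup>2 * (m + 1) \<le> 0"
    using m by (simp add: divide_le_0_iff zero_le_divide_iff)
  then have "(y \<bullet> y)\<^sup>2 \<le> 0"
    using m by (simp add: mult_le_0_iff)
  then show ?thesis
    by (simp add: y_def)
qed

lemma open_orthogonal_to_integer_vector:
  fixes U :: "(real^3) set"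
  assumes "open U" "v \<in> U"
  obtains w k :: "real^3" where "w \<in> U" "k \<noteq> 0" "\<And>i. k $ i \<in> \<int>" "k \<bullet> w = 0"
proof (cases "v $ 1 = 0")
  case True
  show ?thesis
  proof (rule that[of v "axis 1 1"])
    show "(axis 1 1 :: real^3) $ i \<in> \<int>" for i
      by (simp add: axis_def)
  qed (use assms True in \<open>simp_all add: inner_axis'\<close>)
next
  case False
  \<comment> \<open>\<open>g r\<close> replaces the second coordinate of \<open>v\<close> by
    \<open>r * v $ 1\<close>. For rational \<open>r = m / n\<close> it is orthogonal to the integer
    vector \<open>(m, -n, 0)\<close>.\<close>
  define g :: "real \<Rightarrow> real^3" where "g = (\<lambda>r. v + (r * v $ 1 - v $ 2) *\<^sub>R axis 2 1)"
  have "open (g -` U)"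
    using assms(1) by (rule open_vimage) (auto simp: g_def intro!: continuous_intros)
  moreover have "v $ 2 / v $ 1 \<in> g -` U"
    using assms(2) False by (simp add: g_def)
  ultimately obtain e where e: "e > 0" "ball (v $ 2 / v $ 1) e \<subseteq> g -` U"
    by (meson openE)
  obtain r where r: "r \<in> \<rat>" "v $ 2 / v $ 1 < r" "r < v $ 2 / v $ 1 + e"
    using Rats_dense_in_real[of "v $ 2 / v $ 1" "v $ 2 / v $ 1 + e"] e(1) by auto
  then have "g r \<in> U"
    using e(2) by (auto simp: dist_real_def subset_iff)
  obtain m n :: int where mn: "n > 0" "r = of_int m / of_int n"
    using r(1) by (rule Rats_cases')
  define k :: "real^3" where "k = of_int m *\<^sub>R axis 1 1 - of_int n *\<^sub>R axis 2 1"
  show ?thesis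
  proof (rule that[of "g r" k])
    have "k $ 2 \<noteq> 0"
      using mn(1) by (simp add: k_def axis_def)
    then show "k \<noteq> 0" by auto
    show "k $ i \<in> \<int>" for i
      by (simp add: k_def axis_def)
    show "k \<bullet> g r = 0"
      using mn by (simp add: k_def g_def inner_vec_def sum_3 axis_def field_simps)
  qed fact
qed

lemma quadratic_root_exists:
  fixes a b c :: real
  assumes "a < 0" "c \<ge> 0"
  obtains s where "c - 2 * s * b + s\<^sup>2 * a = 0"
proof -
  define r where "r = sqrt (b\<^sup>2 - a * c)"
  have "a * c \<le> 0"
    using assms by (simp add: mult_nonpos_nonneg)
  then have "0 \<le> b\<^sup>2 - a * c"
    using zero_le_power2[of b] by linarith
  then have "r\<^sup>2 = b\<^sup>2 - a * c"
    by (simp add: r_def)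
  \<comment> \<open>Completing the square: \<open>a\<close> times the quadratic in \<open>s\<close>
    is \<open>(a * s - b)\<^sup>2 - (b\<^sup>2 - a * c)\<close>, and \<open>a * s - b = r\<close> at
    the chosen root.\<close>
  then have "a * (c - 2 * ((b + r) / a) * b + ((b + r) / a)\<^sup>2 * a) = 0"
    using assms(1) by (simp add: right_diff_distrib distrib_left power2_eq_square) algebra
  then have "c - 2 * ((b + r) / a) * b + ((b + r) / a)\<^sup>2 * a = 0"
    using assms(1) by simp
  then show ?thesis by (rule that)
qed

text \<open>No deformation is required here: \<open>shear 0 0 0\<close> is the identity, written as
  a shear so that both cases of the final construction have one form.\<close>

lemma not_inj_measurement_map_coplanar:
  fixes n :: "real^3"
  assumes "n \<noteq> 0" and "\<And>j. j \<in> {1..M} \<Longrightarrow> n \<bullet> d j = 0"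
  shows "\<not> inj_on (measurement_map M d (shear 0 0 0)) trace_free_symmetric"
proof -
  obtain w :: "real^3" where w: "w \<noteq> 0" "n \<bullet> w = 0"
    using orthogonal_to_vector_exists[of n] by (auto simp: orthogonal_def)
  define A :: "real^3^3" where "A = (\<chi> i j. n $ i * w $ j + w $ i * n $ j)"
  have Ay: "A *v y = (w \<bullet> y) *\<^sub>R n + (n \<bullet> y) *\<^sub>R w" for y
    by (simp add: vec_eq_iff A_def matrix_vector_mult_def inner_vec_def sum_3 algebra_simps)
  have "w \<bullet> (A *v n) = (n \<bullet> n) * (w \<bullet> w)"
    using w(2) by (simp add: Ay inner_add_right inner_commute)
  then have "A \<noteq> 0"
    using assms(1) w(1) by auto
  moreover have "transpose A = A"
    by (simp add: A_def transpose_def vec_eq_iff)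
  moreover have "trace A = 2 * (n \<bullet> w)"
    by (simp add: A_def trace_def inner_vec_def sum_3)
  ultimately show ?thesis
    using assms w(2)
    by (intro not_inj_measurement_map_shear[where A = A])
       (simp_all add: Ay inner_add_right inner_commute)
qed

lemma exists_degenerate_shear:
  fixes d :: "nat \<Rightarrow> real^3"
  assumes "M \<le> 5"
  obtains s v k where "\<And>i. k $ i \<in> \<int>" "k \<bullet> v = 0"
    "\<not> inj_on (measurement_map M d (shear s v k)) trace_free_symmetric"
proof -
  obtain A0 :: "real^3^3" where A0: "A0 \<noteq> 0" "transpose A0 = A0"
      "\<And>j. j \<in> {1..M} \<Longrightarrow> d j \<bullet> (A0 *v d j) = 0"
    using exists_symmetric_annihilating[OF assms] by blast
  \<comment> \<open>The sign is free, and a nonnegative trace makes the quadratic in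
    \<open>s\<close> solvable once \<open>v \<bullet> (A *v v) < 0\<close>.\<close>
  define A where "A = (if trace A0 \<ge> 0 then A0 else - A0)"
  have "transpose (- A0) = - A0"
    using A0(2) by (simp add: transpose_def vec_eq_iff)
  moreover have "trace (- A0) = - trace A0"
    by (simp add: trace_def sum_negf)
  moreover have "(- A0) *v x = - (A0 *v x)" for x
    by (simp add: vec_eq_iff matrix_vector_mult_def sum_negf)
  ultimately have A: "A \<noteq> 0" "transpose A = A" "trace A \<ge> 0"
      and d: "\<And>j. j \<in> {1..M} \<Longrightarrow> d j \<bullet> (A *v d j) = 0"
    using A0 by (auto simp: A_def)
  show ?thesis
  proof (cases "\<exists>v. v \<bullet> (A *v v) < 0")
    case True
    have "open {v. v \<bullet> (A *v v) < 0}"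
      by (intro open_Collect_less continuous_on_inner continuous_on_id continuous_on_const
          matrix_vector_mult_linear_continuous_on)
    then obtain v k :: "real^3" where vk: "v \<bullet> (A *v v) < 0" "k \<noteq> 0" "\<And>i. k $ i \<in> \<int>" "k \<bullet> v = 0"
      using True by (auto elim: open_orthogonal_to_integer_vector)
    have "(k \<bullet> k) * (v \<bullet> (A *v v)) < 0"
      using vk by (simp add: mult_pos_neg)
    then obtain s where
      "trace A - 2 * s * (v \<bullet> (A *v k)) + s\<^sup>2 * ((k \<bullet> k) * (v \<bullet> (A *v v))) = 0"
      using quadratic_root_exists A(3) by blast
    then have "\<not> inj_on (measurement_map M d (shear s v k)) trace_free_symmetric"
      by (intro not_inj_measurement_map_shear[OF vk(4) A(1,2) d]) (simp_all add: mult.assoc)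
    with vk show ?thesis
      by (intro that)
  next
    case False
    then have ker: "A *v d j = 0" if "j \<in> {1..M}" for j
      using psd_isotropic_in_kernel[OF A(2)] d[OF that] by (meson not_less)
    \<comment> \<open>All \<open>d j\<close> lie in the kernel of \<open>A\<close>, so any nonzero
      row is a common normal to them.\<close>
    obtain i where "A $ i \<noteq> 0"
      using A(1) by (auto simp: vec_eq_iff[of A])
    moreover have "A $ i \<bullet> d j = 0" if "j \<in> {1..M}" for j
      using ker[OF that] by (metis matrix_vector_mul_component zero_index)
    ultimately show ?thesis
      using not_inj_measurement_map_coplanar that[of 0 0 0] by auto
  qed
qed

theorem corollary4p3:
  fixes M :: nat and d :: "nat \<Rightarrow> real^3"
  assumes "M \<le> 5"
    and "\<forall>j\<in>{1..M}. d j \<in> sphere 0 1"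
  shows "\<exists>F :: real^3^3.
      det F = 1 \<and>
      \<not> inj_on (measurement_map M d F) trace_free_symmetric \<and>
      (\<exists>a T. T > 0 \<and>
         (\<exists>u p. euler_solution u p \<and> attains_deformation_gradient u a T F) \<and>
         (\<forall>\<nu>>0. \<exists>u p. navier_stokes_solution \<nu> u p \<and> attains_deformation_gradient u a T F))"
proof -
  obtain s v k where k: "\<And>i. k $ i \<in> \<int>" and kv: "k \<bullet> v = 0"
      and "\<not> inj_on (measurement_map M d (shear s v k)) trace_free_symmetric"
    using exists_degenerate_shear[OF assms(1)] by blast
  \<comment> \<open>One statement for \<open>\<nu> \<ge> 0\<close> serves Euler and Navier--Stokes,
    with the same material point 0 and time 1.\<close>
  moreover have "\<exists>u p. navier_stokes_solution \<nu> u p \<and>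
      attains_deformation_gradient u 0 1 (shear s v k)" if "\<nu> \<ge> 0" for \<nu>
    by (rule shear_attained[OF k kv that])
  ultimately show ?thesis
    using det_shear[OF kv] by (intro exI[of _ "shear s v k"] conjI exI[of _ 0] exI[of _ 1]) auto
qed

end
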